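(* Let $a,t\in\mathbb{R}$ and suppose that one of the following three cases holds: (7.1) $-2\le a<-1$ and $t\in[0,-a-1]$; (7.2) $-4<a<-2$ and $t\in[0,t_1]\cup[-a-1,t_2]$; (7.3) $a\le-4$ and $t\in[-a-1,t_2]$. Then for $c\in\mathbb{R}$ the inequality $f(x,y,z)=w_4+a w_3+b(t) w_2+c w_1\ge 0$ holds for all nonnegative real $x,y,z$ if and only if $c\ge c(t)$. Moreover, when $c=c(t)$ we have $f(t,1,1)=f(1,t,1)=f(1,1,t)=0$.
   Context: For real $x,y,z$: $w_4=x^4+y^4+z^4$, $w_3=x^3y+y^3z+z^3x+xy^3+yz^3+zx^3$, $w_2=x^2y^2+y^2z^2+z^2x^2$, $w_1=xyz(x+y+z)$. For a fixed real $a$ and real $t\ne-\frac12$, define $$c(t)=\frac{2t^4+2(a+1)t^3+(2a+4)t^2+(3a+4)t-a}{2t+1},$$ $$b(t)=\frac{t^4+(a+4)t^3+(5a+4)t^2+4(a+1)t+2a+2}{-(2t+1)}.$$ When $(a+2)(a-4)\ge 0$, define $$t_1=\frac{-a-\sqrt{(a+2)(a-4)}}{2},\qquad t_2=\frac{-a+\sqrt{(a+2)(a-4)}}{2}.$$ *)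

theory Defs
  imports Complex_Main
begin

definition w4 :: "real \<Rightarrow> real \<Rightarrow> real \<Rightarrow> real" where
  "w4 x y z = x^4 + y^4 + z^4"

definition w3 :: "real \<Rightarrow> real \<Rightarrow> real \<Rightarrow> real" where
  "w3 x y z = x^3*y + y^3*z + z^3*x + x*y^3 + y*z^3 + z*x^3"

definition w2 :: "real \<Rightarrow> real \<Rightarrow> real \<Rightarrow> real" where
  "w2 x y z = x^2*y^2 + y^2*z^2 + z^2*x^2"

definition w1 :: "real \<Rightarrow> real \<Rightarrow> real \<Rightarrow> real" where
  "w1 x y z = x*y*z*(x + y + z)"

(* Both quotients are meant for t \<noteq> -1/2; at t = -1/2 they take the junk value 0. *)
definition c_fun :: "real \<Rightarrow> real \<Rightarrow> real" where
  "c_fun a t = (2*t^4 + 2*(a + 1)*t^3 + (2*a + 4)*t^2 + (3*a + 4)*t - a) / (2*t + 1)"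

definition b_fun :: "real \<Rightarrow> real \<Rightarrow> real" where
  "b_fun a t =
     (t^4 + (a + 4)*t^3 + (5*a + 4)*t^2 + 4*(a + 1)*t + 2*a + 2) / (- (2*t + 1))"

(* The next two are meant for (a + 2)*(a - 4) \<ge> 0; sqrt is odd on negative arguments. *)
definition t1 :: "real \<Rightarrow> real" where
  "t1 a = (- a - sqrt ((a + 2)*(a - 4))) / 2"

definition t2 :: "real \<Rightarrow> real" where
  "t2 a = (- a + sqrt ((a + 2)*(a - 4))) / 2"

definition f_quartic :: "real \<Rightarrow> real \<Rightarrow> real \<Rightarrow> real \<Rightarrow> real \<Rightarrow> real \<Rightarrow> real" where
  "f_quartic a b c x y z = w4 x y z + a * w3 x y z + b * w2 x y z + c * w1 x y z"

end

theory Submission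
  imports Defs
begin

text \<open>
  Two nonnegative symmetric quartics vanish at \<open>(t, 1, 1)\<close>:
  \<open>S = \<Sum>(x - y)(x - z)(x - t y)(x - t z)\<close> and
  \<open>T = ((2 t + 1)(x + y + z)\<^sup>2 - (t + 2)\<^sup>2 (x y + y z + z x))\<^sup>2\<close>.
  Up to scaling, the pencil they span consists (for fixed \<open>t\<close>) of the quartics \<open>w4 + a w3 + b(t) w2 + c(t) w1\<close>, and
  the hypotheses on \<open>a\<close> and \<open>t\<close> ensure that the coefficients of \<open>S\<close> and \<open>T\<close> are nonnegative
  (for \<open>t \<noteq> 1\<close>; at \<open>t = 1\<close> the two have the same \<open>w3\<close>-coefficient and \<open>a = -2\<close> is forced).
  Conversely \<open>c \<ge> c(t)\<close> is necessary by evaluating at \<open>(t, 1, 1)\<close>, or, if \<open>t = 0\<close>, near it.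
\<close>

text \<open>Each square vanishes at \<open>(t, 1, 1)\<close> and its permutations: where one factor
  does not vanish by equality of two variables, the other does.\<close>

lemma sum_quartic_eq_sum_squares:
  fixes t x y z :: real
  shows "(x - y) * (x - z) * (x - t*y) * (x - t*z) + (y - z) * (y - x) * (y - t*z) * (y - t*x)
           + (z - x) * (z - y) * (z - t*x) * (z - t*y)
         = (((y - z) * (y + z - (t + 1)*x))\<^sup>2 + ((z - x) * (z + x - (t + 1)*y))\<^sup>2
             + ((x - y) * (x + y - (t + 1)*z))\<^sup>2) / 2"
  by algebra

lemma sum_quartic_nonneg:
  fixes t x y z :: real
  shows "0 \<le> (x - y) * (x - z) * (x - t*y) * (x - t*z) + (y - z) * (y - x) * (y - t*z) * (y - t*x)
           + (z - x) * (z - y) * (z - t*x) * (z - t*y)"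
  unfolding sum_quartic_eq_sum_squares by simp

text \<open>Clearing the denominators of \<open>b_fun\<close> and \<open>c_fun\<close> leaves
  polynomial identities, which \<open>algebra\<close> can decide.\<close>

lemma scaled_f_quartic:
  assumes "2*t + 1 \<noteq> 0"
  shows "(2*t + 1) * f_quartic a (b_fun a t) (c_fun a t) x y z
       = (2*t + 1) * (w4 x y z + a * w3 x y z)
         - (t^4 + (a + 4)*t^3 + (5*a + 4)*t^2 + 4*(a + 1)*t + 2*a + 2) * w2 x y z
         + (2*t^4 + 2*(a + 1)*t^3 + (2*a + 4)*t^2 + (3*a + 4)*t - a) * w1 x y z"
proof -
  have "(2*t + 1) * b_fun a t = - (t^4 + (a + 4)*t^3 + (5*a + 4)*t^2 + 4*(a + 1)*t + 2*a + 2)"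
    using assms by (simp only: b_fun_def divide_minus_right mult_minus_right times_divide_eq_right
        nonzero_mult_div_cancel_left not_False_eq_True)
  moreover have "(2*t + 1) * c_fun a t = 2*t^4 + 2*(a + 1)*t^3 + (2*a + 4)*t^2 + (3*a + 4)*t - a"
    using assms by (simp add: c_fun_def)
  ultimately show ?thesis
    unfolding f_quartic_def by algebra
qed

text \<open>The two weights come from matching the coefficients of \<open>w4\<close> and
  \<open>w3\<close>, a linear system with determinant \<open>3*(1 - t)\<close> up to sign and powers
  of \<open>2*t + 1\<close>. The coefficients of \<open>w2\<close> and \<open>w1\<close> then match
  as well.\<close>

lemma f_quartic_decomposition:
  assumes "2*t + 1 \<noteq> 0"
  shows "3 * (1 - t) * ((2*t + 1) * f_quartic a (b_fun a t) (c_fun a t) x y z)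
       = (a*(2*t + 1) + 2*t\<^sup>2 + 4) * (2*t + 1) *
           ((x - y) * (x - z) * (x - t*y) * (x - t*z) + (y - z) * (y - x) * (y - t*z) * (y - t*x)
             + (z - x) * (z - y) * (z - t*x) * (z - t*y))
         - (a + 1 + t) * ((2*t + 1) * (x + y + z)\<^sup>2 - (t + 2)\<^sup>2 * (x*y + y*z + z*x))\<^sup>2"
  unfolding scaled_f_quartic[OF assms] w4_def w3_def w2_def w1_def by algebra

lemma f_quartic_nonneg:
  fixes a t x y z :: real
  assumes "0 \<le> t"
    and cases: "t < 1 \<and> 0 \<le> a*(2*t + 1) + 2*t\<^sup>2 + 4 \<and> a + 1 + t \<le> 0
      \<or> 1 < t \<and> a*(2*t + 1) + 2*t\<^sup>2 + 4 \<le> 0 \<and> 0 \<le> a + 1 + t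
      \<or> t = 1 \<and> a = -2"
  shows "0 \<le> f_quartic a (b_fun a t) (c_fun a t) x y z"
proof -
  define S where "S = (x - y) * (x - z) * (x - t*y) * (x - t*z)
    + (y - z) * (y - x) * (y - t*z) * (y - t*x) + (z - x) * (z - y) * (z - t*x) * (z - t*y)"
  define T where "T = ((2*t + 1) * (x + y + z)\<^sup>2 - (t + 2)\<^sup>2 * (x*y + y*z + z*x))\<^sup>2"
  define F where "F = f_quartic a (b_fun a t) (c_fun a t) x y z"
  have d: "0 < 2*t + 1"
    using assms(1) by simp
  have S: "0 \<le> (2*t + 1) * S"
    unfolding S_def using sum_quartic_nonneg d by simp
  have T: "0 \<le> T"
    unfolding T_def by simp
  have dec: "3 * (1 - t) * ((2*t + 1) * F)
      = (a*(2*t + 1) + 2*t\<^sup>2 + 4) * ((2*t + 1) * S) - (a + 1 + t) * T"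
    unfolding F_def S_def T_def using f_quartic_decomposition[of t a x y z] d by (simp add: mult.assoc)
  from cases consider
      (lt) "t < 1" "0 \<le> a*(2*t + 1) + 2*t\<^sup>2 + 4" "a + 1 + t \<le> 0"
    | (gt) "1 < t" "a*(2*t + 1) + 2*t\<^sup>2 + 4 \<le> 0" "0 \<le> a + 1 + t"
    | (eq) "t = 1" "a = -2"
    by blast
  then have "0 \<le> F"
  proof cases
    case lt
    have "0 \<le> 3 * (1 - t) * ((2*t + 1) * F)"
      using mult_nonneg_nonneg[OF lt(2) S] mult_nonpos_nonneg[OF lt(3) T] unfolding dec by linarith
    then show ?thesis
      using lt(1) d by (simp add: zero_le_mult_iff)
  next
    case gt
    have "3 * (1 - t) * ((2*t + 1) * F) \<le> 0"
      using mult_nonpos_nonneg[OF gt(2) S] mult_nonneg_nonneg[OF gt(3) T] unfolding dec by linarith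
    then show ?thesis
      using gt(1) d by (simp add: mult_le_0_iff zero_le_mult_iff)
  next
    case eq
    \<comment> \<open>Here \<open>dec\<close> only says 0 = 0. Both \<open>S\<close> and
      \<open>T\<close> are now constant multiples of this square.\<close>
    have "F = (x\<^sup>2 + y\<^sup>2 + z\<^sup>2 - x*y - y*z - z*x)\<^sup>2"
      unfolding F_def eq f_quartic_def b_fun_def c_fun_def w4_def w3_def w2_def w1_def
      by simp algebra
    then show ?thesis
      by simp
  qed
  then show ?thesis
    unfolding F_def .
qed

lemma f_quartic_zero:
  assumes "2*t + 1 \<noteq> 0"
  shows "f_quartic a (b_fun a t) (c_fun a t) t 1 1 = 0"
proof -
  have "(2*t + 1) * f_quartic a (b_fun a t) (c_fun a t) t 1 1 = 0"
    unfolding scaled_f_quartic[OF assms] w4_def w3_def w2_def w1_def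
    by (simp only: power_one mult_1_left mult_1_right) algebra
  then show ?thesis
    using assms by simp
qed

lemma f_quartic_rotate: "f_quartic a b c y z x = f_quartic a b c x y z"
  unfolding f_quartic_def w4_def w3_def w2_def w1_def by algebra

text \<open>Since \<open>w1\<close> is nonnegative on the nonnegative octant, this makes the quartic
  monotone in \<open>c\<close>, and strictly so where \<open>w1\<close> is positive.\<close>

lemma f_quartic_diff: "f_quartic a b c x y z - f_quartic a b c' x y z = (c - c') * w1 x y z"
  unfolding f_quartic_def by algebra

lemma c_fun_le_if_f_quartic_nonneg:
  assumes "0 \<le> t" and nonneg: "\<And>s. 0 \<le> s \<Longrightarrow> 0 \<le> f_quartic a (b_fun a t) c s 1 1"
  shows "c_fun a t \<le> c"
proof (cases "t = 0")
  case False
  then have "0 < w1 t 1 1"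
    using assms(1) by (simp add: w1_def)
  moreover have "0 \<le> (c - c_fun a t) * w1 t 1 1"
    using f_quartic_diff[of a "b_fun a t" c t 1 1 "c_fun a t"] f_quartic_zero[of t a] nonneg[of t]
      assms(1) by simp
  ultimately show ?thesis
    by (simp add: zero_le_mult_iff)
next
  case True
  \<comment> \<open>The zero \<open>(0, 1, 1)\<close> has \<open>w1 = 0\<close> and so does not
    constrain \<open>c\<close>. Dividing by \<open>s\<close> along \<open>(s, 1, 1)\<close> and
    letting \<open>s\<close> tend to 0 from the right gives 2(a + c) \<ge> 0, while c(0) =
    -a.\<close>
  define g where "g s = 2*(a + c) + (c - 4*a - 4)*s + 2*a*s^2 + s^3" for s
  have f_eq: "f_quartic a (b_fun a t) c s 1 1 = s * g s" for s
    unfolding True f_quartic_def b_fun_def g_def w4_def w3_def w2_def w1_def by simp algebra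
  have "(g \<longlongrightarrow> g 0) (at_right 0)"
    unfolding g_def by (intro tendsto_intros)
  moreover have "eventually (\<lambda>s. 0 \<le> g s) (at_right 0)"
    unfolding eventually_at_right_field
    using f_eq nonneg by (metis less_imp_le zero_le_mult_iff leD less_numeral_extra(1))
  ultimately have "0 \<le> g 0"
    by (intro tendsto_lowerbound) auto
  then show ?thesis
    by (simp add: g_def True c_fun_def)
qed

text \<open>The weight of \<open>S\<close>, as a quadratic in \<open>t\<close>, is 2t^2 + 2at + a +
  4, with discriminant 4(a + 2)(a - 4).\<close>

lemma t1_t2_factorization:
  assumes "0 \<le> (a + 2)*(a - 4)"
  shows "2 * ((t - t1 a) * (t - t2 a)) = a*(2*t + 1) + 2*t\<^sup>2 + 4"
proof -
  have "(sqrt ((a + 2)*(a - 4)))\<^sup>2 = (a + 2)*(a - 4)"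
    using assms by simp
  then show ?thesis
    unfolding t1_def t2_def by algebra
qed

text \<open>At t = 1 the quadratic equals 3(a + 2) < 0, so 1 lies strictly between its
  roots.\<close>

lemma t1_lt_one_lt_t2:
  assumes "a < -2"
  shows "t1 a < 1" and "1 < t2 a"
proof -
  have disc: "0 \<le> (a + 2)*(a - 4)"
    using assms by (intro mult_nonpos_nonpos) auto
  have "t1 a \<le> t2 a"
    using disc by (simp add: t1_def t2_def)
  moreover have "(1 - t1 a) * (1 - t2 a) < 0"
    using t1_t2_factorization[OF disc, of 1] assms by simp
  ultimately show "t1 a < 1" "1 < t2 a"
    by (auto simp: mult_less_0_iff)
qed

lemma admissible_cases:
  fixes a t :: real
  assumes "(- 2 \<le> a \<and> a < - 1 \<and> t \<in> {0 .. - a - 1})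
         \<or> (- 4 < a \<and> a < - 2 \<and> t \<in> {0 .. t1 a} \<union> {- a - 1 .. t2 a})
         \<or> (a \<le> - 4 \<and> t \<in> {- a - 1 .. t2 a})"
  shows "0 \<le> t"
    and "t < 1 \<and> 0 \<le> a*(2*t + 1) + 2*t\<^sup>2 + 4 \<and> a + 1 + t \<le> 0
      \<or> 1 < t \<and> a*(2*t + 1) + 2*t\<^sup>2 + 4 \<le> 0 \<and> 0 \<le> a + 1 + t
      \<or> t = 1 \<and> a = -2"
proof -
  show "0 \<le> t"
    using assms by auto
  from assms consider
      (mid) "-2 \<le> a" "a < -1" "0 \<le> t" "t \<le> -a - 1"
    | (small) "a < -2" "0 \<le> t" "t \<le> t1 a"
    | (large) "a < -2" "-a - 1 \<le> t" "t \<le> t2 a"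
    by fastforce
  then show "t < 1 \<and> 0 \<le> a*(2*t + 1) + 2*t\<^sup>2 + 4 \<and> a + 1 + t \<le> 0
      \<or> 1 < t \<and> a*(2*t + 1) + 2*t\<^sup>2 + 4 \<le> 0 \<and> 0 \<le> a + 1 + t
      \<or> t = 1 \<and> a = -2"
  proof cases
    case mid
    \<comment> \<open>Expanding around t = 1 exhibits both terms as nonnegative for a \<ge> -2.
      Moreover t \<le> -a - 1 \<le> 1, with t = 1 only if a = -2.\<close>
    have "a*(2*t + 1) + 2*t\<^sup>2 + 4 = (a + 2)*(2*t + 1) + 2*(t - 1)\<^sup>2"
      by algebra
    then have "0 \<le> a*(2*t + 1) + 2*t\<^sup>2 + 4"
      using mid by simp
    then show ?thesis
      using mid by (cases "t = 1") auto
  next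
    case small
    have disc: "0 \<le> (a + 2)*(a - 4)"
      using small by (intro mult_nonpos_nonpos) auto
    have "0 \<le> (t - t1 a) * (t - t2 a)"
      using small t1_lt_one_lt_t2[of a] by (intro mult_nonpos_nonpos) auto
    then show ?thesis
      using t1_t2_factorization[OF disc, of t] small t1_lt_one_lt_t2[of a] by auto
  next
    case large
    have disc: "0 \<le> (a + 2)*(a - 4)"
      using large by (intro mult_nonpos_nonpos) auto
    have "(t - t1 a) * (t - t2 a) \<le> 0"
      using large t1_lt_one_lt_t2[of a] by (intro mult_nonneg_nonpos) auto
    then show ?thesis
      using t1_t2_factorization[OF disc, of t] large by auto
  qed
qed

theorem theorem7:
  fixes a t :: real
  assumes "(- 2 \<le> a \<and> a < - 1 \<and> t \<in> {0 .. - a - 1})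
         \<or> (- 4 < a \<and> a < - 2 \<and> t \<in> {0 .. t1 a} \<union> {- a - 1 .. t2 a})
         \<or> (a \<le> - 4 \<and> t \<in> {- a - 1 .. t2 a})"
  shows "(\<forall>c::real.
            (\<forall>x y z. 0 \<le> x \<longrightarrow> 0 \<le> y \<longrightarrow> 0 \<le> z \<longrightarrow>
               0 \<le> f_quartic a (b_fun a t) c x y z)
            \<longleftrightarrow> c_fun a t \<le> c)
       \<and> f_quartic a (b_fun a t) (c_fun a t) t 1 1 = 0
       \<and> f_quartic a (b_fun a t) (c_fun a t) 1 t 1 = 0
       \<and> f_quartic a (b_fun a t) (c_fun a t) 1 1 t = 0"
proof (intro conjI allI iffI impI)
  note t = admissible_cases[OF assms]
  show zero: "f_quartic a (b_fun a t) (c_fun a t) t 1 1 = 0"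
    using t(1) by (intro f_quartic_zero) simp
  show "f_quartic a (b_fun a t) (c_fun a t) 1 t 1 = 0"
    and "f_quartic a (b_fun a t) (c_fun a t) 1 1 t = 0"
    using zero by (metis f_quartic_rotate)+
  fix c :: real
  show "c_fun a t \<le> c"
    if "\<forall>x y z. 0 \<le> x \<longrightarrow> 0 \<le> y \<longrightarrow> 0 \<le> z \<longrightarrow> 0 \<le> f_quartic a (b_fun a t) c x y z"
    using that t(1) by (intro c_fun_le_if_f_quartic_nonneg) auto
  show "0 \<le> f_quartic a (b_fun a t) c x y z"
    if "c_fun a t \<le> c" "0 \<le> x" "0 \<le> y" "0 \<le> z" for x y z
  proof -
    have "0 \<le> (c - c_fun a t) * w1 x y z"
      using that by (simp add: w1_def)
    then show ?thesis
      using f_quartic_diff[of a "b_fun a t" c x y z "c_fun a t"]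
        f_quartic_nonneg[OF t, of x y z] by linarith
  qed
qed

end
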